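(* Let $n, r \geq 1$. Then: (i) $\mathcal{S}_{(r,n)}(x) = \sum_{k=0}^{n} \frac{(n)_k}{(r+k)_k} (-1)^k x^{n-k}$; (ii) $\mathcal{S}_{(r,n)}(x) = r \int_{0}^{1} (x-t)^n (1-t)^{r-1}\, dt$; (iii) $\frac{d}{dx}\mathcal{S}_{(r,n)}(x) = n\, \mathcal{S}_{(r,n-1)}(x)$; (iv) $\mathcal{S}_{(r,n)}(x + y) = \sum_{k=0}^{n} \binom{n}{k} \mathcal{S}_{(r,k)}(x)\, y^{n-k}$; (v) $\operatorname{denom}\left( \mathcal{S}_{(r,n)}(x) \right) = \binom{r+n}{r}$; (vi) for every $\ell \in \mathbb{Z}$, $\operatorname{denom}\left( \mathcal{S}_{(r,n)}(\ell) \right) \mid \binom{r+n}{r}$. In particular, $(\mathcal{S}_{(r,n)}(x))_{n \geq 0}$ is an Appell sequence, with (iii) and (iv) equivalent.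
   Context: For integers $n, r \geq 0$, $\mathcal{S}_{(r,n)}(x) = \sum_{k=0}^{n} \binom{n}{k} (-1)^k x^{n-k} \binom{r+k}{r}^{-1} \in \mathbb{Q}[x]$ (so $\mathcal{S}_{(r,0)}(x)=1$). $(n)_k = n(n-1)\cdots(n-k+1)$ is the falling factorial. For a polynomial $f \in \mathbb{Q}[x]$, $\operatorname{denom}(f)$ is the smallest positive integer $d$ with $d f \in \mathbb{Z}[x]$; for a rational number this is the usual denominator. *)

theory Defs
  imports "HOL-Analysis.Analysis" "HOL-Computational_Algebra.Polynomial"
begin

definition S_poly :: "nat \<Rightarrow> nat \<Rightarrow> rat poly" where
  "S_poly r n =
     (\<Sum>k\<le>n. monom (of_nat (n choose k) * (-1) ^ k * inverse (of_nat ((r + k) choose r))) (n - k))"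

definition ffact :: "'a::comm_ring_1 \<Rightarrow> nat \<Rightarrow> 'a" where
  "ffact x k = (\<Prod>i<k. x - of_nat i)"

definition denom :: "rat poly \<Rightarrow> nat" where
  "denom f = (LEAST d. d > 0 \<and> (\<forall>i. coeff (smult (of_nat d) f) i \<in> \<int>))"

definition rat_denom :: "rat \<Rightarrow> int" where
  "rat_denom q = snd (quotient_of q)"

text \<open>
  \<open>\<rat>[x, y]\<close> is represented as \<open>\<rat>[x][y]\<close>, i.e. as \<^typ>\<open>rat poly poly\<close>: the inner
  polynomials are polynomials in \<open>x\<close>, the outer variable is \<open>y\<close>. The polynomial
  \<open>[:[:0, 1:], 1:]\<close> below is \<open>x + y\<close>, so that \<open>plus_subst f\<close> is \<open>f(x + y)\<close>.
\<close>

definition plus_subst :: "rat poly \<Rightarrow> rat poly poly" where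
  "plus_subst f = pcompose (map_poly (\<lambda>c. [:c:]) f) [:[:0, 1:], 1:]"

definition derivative_rule :: "(nat \<Rightarrow> rat poly) \<Rightarrow> nat \<Rightarrow> bool" where
  "derivative_rule p n \<longleftrightarrow> pderiv (p n) = smult (of_nat n) (p (n - 1))"

text \<open>
  In \<open>\<rat>[x][y]\<close> the term \<open>monom c m\<close> is \<open>c(x) y\<^sup>m\<close>, hence this is the identity
  \<open>p\<^sub>n(x + y) = \<Sum>k\<le>n. (n choose k) p\<^sub>k(x) y\<^bsup>n-k\<^esup>\<close>.
\<close>

definition addition_rule :: "(nat \<Rightarrow> rat poly) \<Rightarrow> nat \<Rightarrow> bool" where
  "addition_rule p n \<longleftrightarrow>
     plus_subst (p n) = (\<Sum>k\<le>n. monom (of_nat (n choose k) * p k) (n - k))"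

definition appell_sequence :: "(nat \<Rightarrow> rat poly) \<Rightarrow> bool" where
  "appell_sequence p \<longleftrightarrow>
     p 0 \<noteq> 0 \<and> (\<forall>n. degree (p n) = n) \<and> (\<forall>n\<ge>1. derivative_rule p n)"

end

(* Multiplied by C(r+n, r), the coefficient of x^i in S_(r,n) becomes (-1)^(n-i) C(r+n, i), so
   C(r+n, r) clears all denominators; the constant coefficient (-1)^n / C(r+n, r) shows that
   nothing smaller does. The integral formula is the binomial theorem combined with the Beta
   integral. The derivative and addition rules are equivalent because (j+1) times the coefficient
   of y^(j+1) in f(x+y) is the coefficient of y^j in f'(x+y). *)

theory Submission
  imports Defs
begin

section \<open>Coefficients, degree and derivative of \<open>S_poly\<close>\<close>

lemma sum_monom_reverse_coeff:
  "coeff (\<Sum>k\<le>n. monom (a k) (n - k)) i = (if i \<le> n then a (n - i) else 0)"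
proof -
  have "coeff (\<Sum>k\<le>n. monom (a k) (n - k)) i = (\<Sum>k\<le>n. if n - k = i then a k else 0)"
    by (simp add: coeff_sum)
  also have "\<dots> = (\<Sum>k\<in>{k. k \<le> n \<and> n - k = i}. a k)"
    by (simp add: sum.If_cases Int_def)
  also have "{k. k \<le> n \<and> n - k = i} = (if i \<le> n then {n - i} else {})"
    by auto
  finally show ?thesis by simp
qed

lemma coeff_S_poly:
  "coeff (S_poly r n) i =
    (if i \<le> n then of_nat (n choose i) * (-1) ^ (n - i) / of_nat ((r + (n - i)) choose r) else 0)"
  by (simp add: S_poly_def sum_monom_reverse_coeff binomial_symmetric[of i n] divide_inverse)

lemma degree_S_poly: "degree (S_poly r n) = n"
proof (rule antisym)
  show "degree (S_poly r n) \<le> n" by (rule degree_le) (simp add: coeff_S_poly)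
  show "n \<le> degree (S_poly r n)" by (rule le_degree) (simp add: coeff_S_poly)
qed

text \<open>The inverse binomial in the coefficient of x^i depends only on n - i, which stays fixed
  when n and i both drop by one; the absorption identity for binomials does the rest.\<close>

lemma derivative_rule_S_poly: "derivative_rule (S_poly r) n"
proof (cases n)
  case 0
  then show ?thesis by (simp add: derivative_rule_def pderiv_eq_0_iff degree_S_poly)
next
  case (Suc m)
  have "of_nat (Suc i) * of_nat (Suc m choose Suc i) = (of_nat (Suc m) * of_nat (m choose i) :: rat)"
    for i
    by (metis Suc_times_binomial_eq mult.commute of_nat_mult)
  then have "coeff (pderiv (S_poly r (Suc m))) i = coeff (smult (of_nat (Suc m)) (S_poly r m)) i" for i
    by (simp only: coeff_pderiv coeff_smult coeff_S_poly Suc_le_mono diff_Suc_Suc) 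
       (simp del: of_nat_Suc binomial_Suc_Suc flip: mult.assoc)
  with Suc show ?thesis by (simp add: derivative_rule_def poly_eq_iff)
qed

section \<open>Falling factorial form\<close>

lemma ffact_of_nat: "ffact (of_nat n) k = (fact k * of_nat (n choose k) :: rat)"
  by (simp add: ffact_def binomial_gbinomial gbinomial_prod_rev lessThan_atLeast0)

text \<open>The factor \<open>fact k\<close> common to both falling factorials cancels.\<close>

lemma S_poly_ffact:
  "S_poly r n = (\<Sum>k\<le>n. monom (ffact (of_nat n) k / ffact (of_nat (r + k)) k * (-1) ^ k) (n - k))"
proof -
  have "(r + k) choose k = (r + k) choose r" for k
    using binomial_symmetric[of k "r + k"] by simp
  then show ?thesis
    unfolding S_poly_def ffact_of_nat by (intro sum.cong refl) (simp add: divide_inverse mult_ac)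
qed

section \<open>Beta integral and integral formula\<close>

lemma has_integral_beta_nat:
  "((\<lambda>t::real. t ^ k * (1 - t) ^ s) has_integral fact k * fact s / fact (k + s + 1)) {0..1}"
proof (induction k arbitrary: s)
  case 0
  have "((\<lambda>t::real. (1 - t) ^ s) has_integral
          - ((1 - 1) ^ Suc s) / real (Suc s) - (- ((1 - 0) ^ Suc s) / real (Suc s))) {0..1}"
    by (rule fundamental_theorem_of_calculus)
       (auto intro!: derivative_eq_intros simp flip: has_real_derivative_iff_has_vector_derivative
             simp del: of_nat_Suc power_Suc)
  moreover have "fact s / fact (s + 1) = 1 / real (Suc s)" by simp
  ultimately show ?case by (simp del: of_nat_Suc fact_Suc)
next
  case (Suc k)
  \<comment> \<open>integration by parts: the integrand is the derivative of \<open>t ^ Suc k * (1 - t) ^ Suc s\<close>\<close>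
  have *: "((\<lambda>t::real. real (Suc k) * (t ^ k * (1 - t) ^ Suc s) - real (Suc s) * (t ^ Suc k * (1 - t) ^ s))
      has_integral 1 ^ Suc k * (1 - 1) ^ Suc s - 0 ^ Suc k * (1 - 0) ^ Suc s) {0..1}"
    by (rule fundamental_theorem_of_calculus)
       (auto intro!: derivative_eq_intros simp flip: has_real_derivative_iff_has_vector_derivative
             simp del: of_nat_Suc power_Suc)
  \<comment> \<open>Subtracting the derivative in \<open>*\<close> from \<open>Suc k\<close> times
    the integrand of the induction hypothesis at \<open>Suc s\<close> isolates the wanted integrand,
    up to the factor \<open>Suc s\<close>.\<close>
  have "((\<lambda>t::real. (1 / real (Suc s)) * (real (Suc k) * (t ^ k * (1 - t) ^ Suc s) -
           (real (Suc k) * (t ^ k * (1 - t) ^ Suc s) - real (Suc s) * (t ^ Suc k * (1 - t) ^ s))))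
      has_integral (1 / real (Suc s)) * (real (Suc k) * (fact k * fact (Suc s) / fact (k + Suc s + 1)) -
           (1 ^ Suc k * (1 - 1) ^ Suc s - 0 ^ Suc k * (1 - 0) ^ Suc s))) {0..1}"
    by (intro has_integral_mult_right has_integral_diff Suc.IH *)
  moreover have "(1 / real (Suc s)) * (real (Suc k) * A - (real (Suc k) * A - real (Suc s) * B)) = B" for A B
    by simp
  moreover have "(1 / real (Suc s)) * (real (Suc k) * (fact k * fact (Suc s) / fact (k + Suc s + 1)) - 0) =
      fact (Suc k) * fact s / fact (Suc k + s + 1)"
    by (simp add: fact_Suc[of s] fact_Suc[of k] del: of_nat_Suc fact_Suc)
  ultimately show ?case by (simp del: of_nat_Suc fact_Suc)
qed

lemma poly_S_poly_integral:
  fixes x :: real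
  assumes "r \<ge> 1"
  shows "poly (map_poly of_rat (S_poly r n)) x =
           real r * integral {0..1} (\<lambda>t. (x - t) ^ n * (1 - t) ^ (r - 1))"
proof -
  obtain s where r: "r = Suc s" using assms by (cases r) auto
  \<comment> \<open>The prefactor r = s + 1 completes s! to r!, and k + s + 1 = r + k, so the Beta
    value becomes an inverse binomial.\<close>
  have beta: "real r * (fact k * fact s / fact (k + s + 1)) = inverse (real ((r + k) choose r))" for k
  proof -
    have "real ((r + k) choose r) = fact (r + k) / (fact r * fact k)"
      using binomial_fact[of r "r + k", where 'a = real] by simp
    then show ?thesis by (simp add: r add_ac)
  qed
  have "((\<lambda>t. \<Sum>k\<le>n. (real (n choose k) * (-1) ^ k * x ^ (n - k)) * (t ^ k * (1 - t) ^ s)) has_integral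
      (\<Sum>k\<le>n. (real (n choose k) * (-1) ^ k * x ^ (n - k)) * (fact k * fact s / fact (k + s + 1)))) {0..1}"
    by (intro has_integral_sum has_integral_mult_right has_integral_beta_nat) auto
  moreover have "(\<Sum>k\<le>n. (real (n choose k) * (-1) ^ k * x ^ (n - k)) * (t ^ k * (1 - t) ^ s))
      = (x - t) ^ n * (1 - t) ^ s" for t
  proof -
    have "(x - t) ^ n = (\<Sum>k\<le>n. real (n choose k) * (- t) ^ k * x ^ (n - k))"
      using binomial_ring[of "- t" x n] by simp
    then show ?thesis
      by (simp add: sum_distrib_left sum_distrib_right power_minus[of t] mult_ac)
  qed
  ultimately have "real r * integral {0..1} (\<lambda>t. (x - t) ^ n * (1 - t) ^ s) =
      (\<Sum>k\<le>n. (real (n choose k) * (-1) ^ k * x ^ (n - k)) *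
         (real r * (fact k * fact s / fact (k + s + 1))))"
    by (simp add: integral_unique sum_distrib_left mult_ac)
  also have "\<dots> = poly (\<Sum>k\<le>n. monom (real (n choose k) * (-1) ^ k *
      inverse (real ((r + k) choose r))) (n - k)) x"
    unfolding beta by (simp add: poly_sum poly_monom mult_ac)
  also have "(\<Sum>k\<le>n. monom (real (n choose k) * (-1) ^ k * inverse (real ((r + k) choose r))) (n - k))
      = map_poly of_rat (S_poly r n)"
    by (rule poly_eqI)
       (simp add: S_poly_def coeff_map_poly sum_monom_reverse_coeff of_rat_mult of_rat_power
         of_rat_inverse of_rat_minus)
  finally show ?thesis by (simp add: r)
qed

section \<open>Denominators\<close>

lemma choose_times_coeff_S_poly:
  assumes "i \<le> n"
  shows "of_nat ((r + n) choose r) * coeff (S_poly r n) i = (-1) ^ (n - i) * of_nat ((r + n) choose i)"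
proof -
  \<comment> \<open>Choosing r + (n - i) elements and then r of those amounts to choosing the r
    first and then n - i of the remaining n.\<close>
  have "((r + n) choose (r + (n - i))) * ((r + (n - i)) choose r) = ((r + n) choose r) * (n choose (n - i))"
    using choose_mult[of r "r + (n - i)" "r + n"] by simp
  moreover have "(r + n) choose (r + (n - i)) = (r + n) choose i"
    using assms binomial_symmetric[of i "r + n"] by simp
  ultimately have "of_nat ((r + n) choose i) * of_nat ((r + (n - i)) choose r) =
      (of_nat ((r + n) choose r) * of_nat (n choose i) :: rat)"
    using assms by (metis binomial_symmetric of_nat_mult)
  then show ?thesis using assms by (simp add: coeff_S_poly field_simps)
qed

lemma choose_times_coeff_S_poly_Ints: "of_nat ((r + n) choose r) * coeff (S_poly r n) i \<in> \<int>"
proof (cases "i \<le> n")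
  case True
  then show ?thesis by (simp only: choose_times_coeff_S_poly) simp
qed (simp add: coeff_S_poly)

lemma denom_S_poly: "denom (S_poly r n) = (r + n) choose r"
  unfolding denom_def
proof (rule Least_equality)
  show "(r + n) choose r > 0 \<and> (\<forall>i. coeff (smult (of_nat ((r + n) choose r)) (S_poly r n)) i \<in> \<int>)"
    by (simp add: choose_times_coeff_S_poly_Ints)
next
  fix d :: nat
  assume d: "d > 0 \<and> (\<forall>i. coeff (smult (of_nat d) (S_poly r n)) i \<in> \<int>)"
  then have "coeff (smult (of_nat d) (S_poly r n)) 0 \<in> \<int>" by blast
  then have "(of_nat d / of_nat ((r + n) choose r) :: rat) \<in> \<int>"
    \<comment> \<open>The constant coefficient carries the sign (-1)^n; the parity split removes it,
      as integrality ignores signs.\<close>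
    by (cases "even n") (simp_all add: coeff_S_poly minus_in_Ints_iff)
  then obtain z where "(of_nat d / of_nat ((r + n) choose r) :: rat) = of_int z"
    by (auto elim: Ints_cases)
  then have "(of_int (int d) :: rat) = of_int (z * int ((r + n) choose r))"
    by (simp add: field_simps)
  then have "int d = z * int ((r + n) choose r)" by (simp only: of_int_eq_iff)
  then have "int ((r + n) choose r) dvd int d" by simp
  with d show "(r + n) choose r \<le> d" by (auto dest: dvd_imp_le)
qed

text \<open>With q = a/b in lowest terms, integrality of m a / b gives b | m a, and coprimality of a
  and b leaves b | m.\<close>

lemma rat_denom_dvd:
  assumes "of_int m * q \<in> \<int>"
  shows "rat_denom q dvd m"
proof -
  obtain a b where ab: "quotient_of q = (a, b)" by fastforce
  then have q: "q = of_int a / of_int b" "b > 0" "coprime a b"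
    by (auto dest: quotient_of_div quotient_of_denom_pos quotient_of_coprime)
  obtain z where "of_int m * q = of_int z" using assms by (auto elim: Ints_cases)
  moreover have "q * of_int b = of_int a" using q by simp
  ultimately have "(of_int (m * a) :: rat) = of_int (z * b)"
    by (metis mult.assoc of_int_mult)
  then have "m * a = z * b" by (simp only: of_int_eq_iff)
  then have "b dvd m * a" by simp
  with q(3) have "b dvd m"
    by (simp add: coprime_commute coprime_dvd_mult_left_iff)
  with ab show ?thesis by (simp add: rat_denom_def)
qed

lemma rat_denom_poly_S_poly: "rat_denom (poly (S_poly r n) (of_int l)) dvd int ((r + n) choose r)"
proof (rule rat_denom_dvd)
  have "of_int (int ((r + n) choose r)) * poly (S_poly r n) (of_int l) =
      (\<Sum>i\<le>n. (of_nat ((r + n) choose r) * coeff (S_poly r n) i) * of_int l ^ i)"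
    by (simp add: poly_altdef degree_S_poly sum_distrib_left mult_ac)
  also have "\<dots> \<in> \<int>"
    by (intro Ints_sum Ints_mult choose_times_coeff_S_poly_Ints Ints_power Ints_of_int)
  finally show "of_int (int ((r + n) choose r)) * poly (S_poly r n) (of_int l) \<in> \<int>" .
qed

section \<open>Substitution of x + y and the equivalence of the two rules\<close>

lemma plus_subst_0: "plus_subst 0 = 0"
  by (simp add: plus_subst_def)

text \<open>One Horner step, the recursion behind the inductions over f below.\<close>

lemma plus_subst_pCons: "plus_subst (pCons a f) = [:[:a:]:] + [:[:0, 1:], 1:] * plus_subst f"
  by (simp add: plus_subst_def map_poly_pCons pcompose_pCons)

lemma plus_subst_add: "plus_subst (f + g) = plus_subst f + plus_subst g"
proof -
  have "map_poly (\<lambda>c. [:c:]) (f + g) = map_poly (\<lambda>c. [:c:]) f + map_poly (\<lambda>c. [:c:]) g"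
    by (rule poly_eqI) (simp add: coeff_map_poly)
  then show ?thesis by (simp add: plus_subst_def pcompose_add)
qed

lemma plus_subst_smult: "plus_subst (smult a f) = smult [:a:] (plus_subst f)"
proof -
  have "map_poly (\<lambda>c. [:c:]) (smult a f) = smult [:a:] (map_poly (\<lambda>c. [:c:]) f)"
    by (rule poly_eqI) (simp add: coeff_map_poly)
  then show ?thesis by (simp add: plus_subst_def pcompose_smult)
qed

lemma coeff_plus_subst_0: "coeff (plus_subst f) 0 = f"
  by (induction f) (simp_all add: plus_subst_0 plus_subst_pCons)

text \<open>Coefficientwise form of d/dy f(x + y) = f'(x + y), by induction along the Horner
  recursion.\<close>

lemma coeff_plus_subst_Suc:
  "smult (of_nat (Suc j)) (coeff (plus_subst f) (Suc j)) = coeff (plus_subst (pderiv f)) j"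
proof (induction f arbitrary: j)
  case 0
  then show ?case by (simp add: plus_subst_0)
next
  case (pCons a f)
  \<comment> \<open>Multiplication by x appears as \<open>pCons 0\<close> on the coefficients in y,
    so the induction hypothesis is also needed under it.\<close>
  have IH: "pCons 0 (coeff (plus_subst (pderiv f)) i) = pCons 0 (smult (of_nat (Suc i)) (coeff (plus_subst f) (Suc i)))" for i
    by (simp only: pCons.IH)
  show ?case
    \<comment> \<open>The coefficient of y^j in (x + y) g is x g_j + g_(j-1), where the second term
      is absent for j = 0.\<close>
    by (cases j)
       (simp_all add: plus_subst_pCons plus_subst_add pderiv_pCons IH coeff_pCons
          smult_add_right smult_add_left numeral_poly algebra_simps flip: pCons.IH)
qed

lemma addition_rule_iff_coeff:
  "addition_rule p m \<longleftrightarrow>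
    (\<forall>j. coeff (plus_subst (p m)) j = (if j \<le> m then smult (of_nat (m choose j)) (p (m - j)) else 0))"
proof -
  have "coeff (\<Sum>k\<le>m. monom (of_nat (m choose k) * p k) (m - k)) j =
      (if j \<le> m then smult (of_nat (m choose j)) (p (m - j)) else 0)" for j
    using binomial_symmetric[of j m] by (simp add: sum_monom_reverse_coeff of_nat_poly)
  then show ?thesis by (simp add: addition_rule_def poly_eq_iff[of "plus_subst (p m)"])
qed

text \<open>Compare coefficients of y^1: in f(x + y) it is f', and m \<ge> 1 puts this power within
  the range of the sum.\<close>

lemma addition_rule_imp_derivative_rule:
  assumes "addition_rule p m" and "m \<ge> 1"
  shows "derivative_rule p m"
proof -
  have "coeff (plus_subst (p m)) 1 = smult (of_nat m) (p (m - 1))"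
    using assms by (simp add: addition_rule_iff_coeff)
  moreover have "coeff (plus_subst (p m)) 1 = pderiv (p m)"
    using coeff_plus_subst_Suc[of 0 "p m"] by (simp add: coeff_plus_subst_0)
  ultimately show ?thesis by (simp add: derivative_rule_def)
qed

text \<open>Induction on the exponent j of y, for all m at once: the coefficient of y^(j+1) for
  \<open>p m\<close> reduces to that of y^j for \<open>p (m - 1)\<close>. As the rule is assumed
  only from m = 1 on, \<open>p 0\<close> must be constant separately.\<close>

lemma derivative_rule_imp_addition_rule:
  assumes "degree (p 0) = 0" and rule: "\<And>m. m \<ge> 1 \<Longrightarrow> derivative_rule p m"
  shows "addition_rule p m"
proof -
  have "coeff (plus_subst (p m)) j = (if j \<le> m then smult (of_nat (m choose j)) (p (m - j)) else 0)" for j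
  proof (induction j arbitrary: m)
    case 0
    then show ?case by (simp add: coeff_plus_subst_0)
  next
    case (Suc j)
    \<comment> \<open>Both sides carry the factor j + 1 so that the coefficient passes to the
      derivative; it is nonzero in characteristic 0 and is cancelled afterwards.\<close>
    have "smult (of_nat (Suc j)) (coeff (plus_subst (p m)) (Suc j)) =
        smult (of_nat (Suc j)) (if Suc j \<le> m then smult (of_nat (m choose Suc j)) (p (m - Suc j)) else 0)"
    proof (cases m)
      case 0
      then have "pderiv (p m) = 0" using assms(1) by (simp add: pderiv_eq_0_iff)
      with 0 show ?thesis by (simp add: coeff_plus_subst_Suc plus_subst_0 del: of_nat_Suc)
    next
      case (Suc l)
      have "of_nat (Suc j) * of_nat (Suc l choose Suc j) = (of_nat (Suc l) * of_nat (l choose j) :: rat)"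
        by (metis Suc_times_binomial_eq mult.commute of_nat_mult)
      moreover have "pderiv (p m) = smult (of_nat (Suc l)) (p l)"
        using rule[of m] Suc by (simp add: derivative_rule_def)
      ultimately show ?thesis
        using Suc by (simp add: coeff_plus_subst_Suc plus_subst_smult Suc.IH
            del: of_nat_Suc binomial_Suc_Suc)
    qed
    then show ?case by (rule smult_cancel[rotated]) (simp del: of_nat_Suc)
  qed
  then show ?thesis by (simp add: addition_rule_iff_coeff)
qed

theorem theorem2p1:
  fixes n r :: nat
  assumes "n \<ge> 1" and "r \<ge> 1"
  shows
    "S_poly r n =
       (\<Sum>k\<le>n. monom (ffact (of_nat n) k / ffact (of_nat (r + k)) k * (-1) ^ k) (n - k))
     \<and> (\<forall>x::real. poly (map_poly of_rat (S_poly r n)) x =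
           real r * integral {0..1} (\<lambda>t. (x - t) ^ n * (1 - t) ^ (r - 1)))
     \<and> pderiv (S_poly r n) = smult (of_nat n) (S_poly r (n - 1))
     \<and> plus_subst (S_poly r n) =
           (\<Sum>k\<le>n. monom (of_nat (n choose k) * S_poly r k) (n - k))
     \<and> denom (S_poly r n) = (r + n) choose r
     \<and> (\<forall>l::int. rat_denom (poly (S_poly r n) (of_int l)) dvd int ((r + n) choose r))
     \<and> appell_sequence (S_poly r)
     \<and> (\<forall>p. degree (p 0) = 0 \<longrightarrow>
           ((\<forall>m\<ge>1. derivative_rule p m) \<longleftrightarrow> (\<forall>m\<ge>1. addition_rule p m)))"
proof (intro conjI allI impI)
  \<comment> \<open>The addition formula comes from the derivative rule through the general
    implication, with no direct expansion.\<close>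
  show "plus_subst (S_poly r n) = (\<Sum>k\<le>n. monom (of_nat (n choose k) * S_poly r k) (n - k))"
    using derivative_rule_imp_addition_rule[of "S_poly r" n]
    by (simp add: derivative_rule_S_poly degree_S_poly addition_rule_def)
  have "S_poly r 0 \<noteq> 0" by (simp add: S_poly_def)
  then show "appell_sequence (S_poly r)"
    by (simp add: appell_sequence_def degree_S_poly derivative_rule_S_poly)
  show "pderiv (S_poly r n) = smult (of_nat n) (S_poly r (n - 1))"
    using derivative_rule_S_poly by (simp add: derivative_rule_def)
  fix p :: "nat \<Rightarrow> rat poly"
  assume "degree (p 0) = 0"
  then show "(\<forall>m\<ge>1. derivative_rule p m) \<longleftrightarrow> (\<forall>m\<ge>1. addition_rule p m)"
    using addition_rule_imp_derivative_rule derivative_rule_imp_addition_rule by blast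
qed (rule S_poly_ffact poly_S_poly_integral denom_S_poly rat_denom_poly_S_poly assms)+

end
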